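(* Let $(X,\mathrm{d})$ be a compact metric space. For every finite approximative sequence (FAS) $\{U_{2\varepsilon_n}(A_n),p_{n,n+1}\}_{n\in\mathbb{N}}$ of $X$, its inverse limit $$\mathcal{X}=\varprojlim\{U_{2\varepsilon_n}(A_n),p_{n,n+1}\}$$ contains a subspace $\mathcal{X}^*\subset\mathcal{X}$ which is homeomorphic to $X$ and is a strong deformation retract of $\mathcal{X}$.
   Context: Let $(X,\mathrm{d})$ be a compact metric space. Hyperspaces: $2^X$ is the set of non-empty closed subsets of $X$. The upper semifinite topology on $2^X$ has as base the sets $B(U)=\{C\in 2^X: C\subset U\}$, $U\subset X$ open; the resulting space is $2^X_u$. If $A\subset X$ is finite and non-empty, $2^A_u$ is the (finite) set of non-empty subsets of $A$ with the upper semifinite topology, i.e. the topology with base the sets $2^C=\{D: \emptyset\neq D\subset C\}$, $\emptyset\ne C\subset A$. For $\varepsilon>0$, $U_{2\varepsilon}(A)=\{C\in 2^A:\operatorname{diam}(C)<2\varepsilon\}\subset 2^A_u$ with the subspace topology. Approximations: A finite subset $A\subset X$ is a finite $\varepsilon$-approximation of $X$ if for every $x\in X$ there is $a\in A$ with $\mathrm{d}(x,a)<\varepsilon$. For $x\in X$ put $A(x)=\{a\in A:\mathrm{d}(x,a)=\mathrm{d}(x,A)\}$ and, for $C\in 2^X$, $r_A(C)=\bigcup_{c\in C}A(c)$. If $A$ is a finite $\varepsilon$-approximation, let $\gamma=\sup\{\mathrm{d}(x,A):x\in X\}$ (so $\gamma<\varepsilon$). A number $0<\varepsilon'<\varepsilon$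 is adjusted to $A$ if $\varepsilon'<\frac{\varepsilon-\gamma}{2}$. In that case, for every finite $\varepsilon'$-approximation $A'$, the map $p:U_{2\varepsilon'}(A')\to U_{2\varepsilon}(A)$, $p(C)=r_A(C)$, is well defined and continuous. FAS: A finite approximative sequence of $X$ is an inverse sequence $\{U_{2\varepsilon_n}(A_n),p_{n,n+1}\}_{n\in\mathbb{N}}$ (with $n\geq 1$), where $\{\varepsilon_n\}$ is a sequence of positive reals converging to zero, each $A_n$ is a finite $\varepsilon_n$-approximation of $X$, $\varepsilon_{n+1}$ is adjusted to $A_n$ for every $n$, and $p_{n,n+1}:U_{2\varepsilon_{n+1}}(A_{n+1})\to U_{2\varepsilon_n}(A_n)$ is $p_{n,n+1}(C)=r_{A_n}(C)$. Its inverse limit is the subspace of $\prod_n U_{2\varepsilon_n}(A_n)$ of sequences $\{C_n\}$ with $p_{n,n+1}(C_{n+1})=C_n$ for all $n$. *)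

theory Defs
  imports "HOL-Analysis.Analysis"
begin

definition nonempty_subsets :: "'a set \<Rightarrow> 'a set set" where
  "nonempty_subsets A = {C. C \<noteq> {} \<and> C \<subseteq> A}"

text \<open>The upper semifinite topology on the set of non-empty subsets of a finite set \<open>A\<close>.  The
  generating family is a base, not merely a subbase: see \<open>openin_finite_hyperspace_iff\<close>.\<close>

definition finite_hyperspace :: "'a set \<Rightarrow> 'a set topology" where
  "finite_hyperspace A = topology_generated_by {nonempty_subsets C | C. C \<noteq> {} \<and> C \<subseteq> A}"

text \<open>The space \<open>U\<^sub>2\<^sub>\<epsilon>(A)\<close>; the factor 2 is built in, so the argument is \<open>\<epsilon>\<close>.\<close>

definition small_hyperspace :: "real \<Rightarrow> 'a::metric_space set \<Rightarrow> 'a set topology" where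
  "small_hyperspace \<epsilon> A =
     subtopology (finite_hyperspace A) {C \<in> nonempty_subsets A. diameter C < 2 * \<epsilon>}"

definition finite_approximation :: "'a::metric_space set \<Rightarrow> real \<Rightarrow> 'a set \<Rightarrow> bool" where
  "finite_approximation X \<epsilon> A \<longleftrightarrow>
     finite A \<and> A \<subseteq> X \<and> (\<forall>x\<in>X. \<exists>a\<in>A. dist x a < \<epsilon>)"

definition nearest_points :: "'a::metric_space set \<Rightarrow> 'a \<Rightarrow> 'a set" where
  "nearest_points A x = {a \<in> A. dist x a = infdist x A}"

definition nearest_map :: "'a::metric_space set \<Rightarrow> 'a set \<Rightarrow> 'a set" where
  "nearest_map A C = (\<Union>c\<in>C. nearest_points A c)"

definition approximation_radius :: "'a::metric_space set \<Rightarrow> 'a set \<Rightarrow> real" where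
  "approximation_radius X A = (SUP x\<in>X. infdist x A)"

definition adjusted :: "'a::metric_space set \<Rightarrow> real \<Rightarrow> 'a set \<Rightarrow> real \<Rightarrow> bool" where
  "adjusted X \<epsilon> A \<epsilon>' \<longleftrightarrow>
     0 < \<epsilon>' \<and> \<epsilon>' < \<epsilon> \<and> \<epsilon>' < (\<epsilon> - approximation_radius X A) / 2"

text \<open>The spaces and bonding maps of a finite approximative sequence are determined by the
  numbers \<open>\<epsilon> n\<close> and the sets \<open>A n\<close>, so the sequence is represented by these data.\<close>

definition finite_approximative_sequence ::
    "'a::metric_space set \<Rightarrow> (nat \<Rightarrow> real) \<Rightarrow> (nat \<Rightarrow> 'a set) \<Rightarrow> bool" where
  "finite_approximative_sequence X \<epsilon> A \<longleftrightarrow>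
     (\<forall>n. 0 < \<epsilon> n) \<and> \<epsilon> \<longlonglongrightarrow> 0 \<and>
     (\<forall>n. finite_approximation X (\<epsilon> n) (A n)) \<and>
     (\<forall>n. adjusted X (\<epsilon> n) (A n) (\<epsilon> (Suc n)))"

text \<open>In an inverse sequence, \<open>p n\<close> is the bonding map from stage \<open>Suc n\<close> to stage \<open>n\<close>.\<close>

definition inverse_limit :: "(nat \<Rightarrow> 'a topology) \<Rightarrow> (nat \<Rightarrow> 'a \<Rightarrow> 'a) \<Rightarrow> (nat \<Rightarrow> 'a) topology" where
  "inverse_limit T p = subtopology (product_topology T UNIV) {C. \<forall>n. p n (C (Suc n)) = C n}"

definition fas_limit :: "(nat \<Rightarrow> real) \<Rightarrow> (nat \<Rightarrow> 'a::metric_space set) \<Rightarrow> (nat \<Rightarrow> 'a set) topology" where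
  "fas_limit \<epsilon> A =
     inverse_limit (\<lambda>n. small_hyperspace (\<epsilon> n) (A n)) (\<lambda>n. nearest_map (A n))"

definition strong_deformation_retract_of :: "'a set \<Rightarrow> 'a topology \<Rightarrow> bool"
    (infix \<open>strong'_deformation'_retract'_of\<close> 50) where
  "S strong_deformation_retract_of T \<longleftrightarrow>
     S \<subseteq> topspace T \<and>
     (\<exists>r. retraction_maps T (subtopology T S) r id \<and>
          homotopic_with (\<lambda>h. \<forall>s\<in>S. h s = s) T T id r)"

lemma openin_finite_hyperspace_iff:
  "openin (finite_hyperspace A) V \<longleftrightarrow>
     (arbitrary union_of (\<lambda>B. \<exists>C. C \<noteq> {} \<and> C \<subseteq> A \<and> B = nonempty_subsets C)) V"
  (is "_ \<longleftrightarrow> (arbitrary union_of ?B) V")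
proof -
  have char: "(arbitrary union_of ?B) V \<longleftrightarrow>
      V \<subseteq> nonempty_subsets A \<and> (\<forall>D\<in>V. nonempty_subsets D \<subseteq> V)" for V
  proof
    assume "(arbitrary union_of ?B) V"
    then obtain \<U> where "\<U> \<subseteq> Collect ?B" "\<Union>\<U> = V"
      by (auto simp: union_of_def)
    then show "V \<subseteq> nonempty_subsets A \<and> (\<forall>D\<in>V. nonempty_subsets D \<subseteq> V)"
      unfolding nonempty_subsets_def by blast
  next
    assume R: "V \<subseteq> nonempty_subsets A \<and> (\<forall>D\<in>V. nonempty_subsets D \<subseteq> V)"
    then have "\<Union>(nonempty_subsets ` V) = V"
      unfolding nonempty_subsets_def by blast
    moreover have "nonempty_subsets ` V \<subseteq> Collect ?B"
    proof (intro image_subsetI CollectI)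
      fix D assume "D \<in> V"
      with R have "D \<in> nonempty_subsets A" by blast
      then show "?B (nonempty_subsets D)"
        by (intro exI[of _ D]) (simp add: nonempty_subsets_def)
    qed
    ultimately show "(arbitrary union_of ?B) V"
      unfolding union_of_def arbitrary_def by (intro exI[of _ "nonempty_subsets ` V"]) simp
  qed
  show ?thesis
  proof
    assume "openin (finite_hyperspace A) V"
    then have "generate_topology_on {nonempty_subsets C | C. C \<noteq> {} \<and> C \<subseteq> A} V"
      by (simp add: finite_hyperspace_def openin_topology_generated_by_iff)
    then have "V \<subseteq> nonempty_subsets A \<and> (\<forall>D\<in>V. nonempty_subsets D \<subseteq> V)"
    proof (induction rule: generate_topology_on.induct)
      case (Basis s)
      then show ?case unfolding nonempty_subsets_def by blast
    qed blast+
    then show "(arbitrary union_of ?B) V"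
      by (rule char[THEN iffD2])
  next
    assume "(arbitrary union_of ?B) V"
    then obtain \<U> where "\<U> \<subseteq> Collect ?B" "\<Union>\<U> = V"
      by (auto simp: union_of_def)
    then show "openin (finite_hyperspace A) V"
      unfolding finite_hyperspace_def
      by (blast intro: openin_Union topology_generated_by_Basis)
  qed
qed

lemma topspace_finite_hyperspace: "topspace (finite_hyperspace A) = nonempty_subsets A"
  by (auto simp: finite_hyperspace_def nonempty_subsets_def)

lemma topspace_small_hyperspace:
  "topspace (small_hyperspace \<epsilon> A) = {C. C \<noteq> {} \<and> C \<subseteq> A \<and> diameter C < 2 * \<epsilon>}"
  by (auto simp: small_hyperspace_def topspace_finite_hyperspace nonempty_subsets_def)

lemma strong_deformation_retract_of_iff:
  "S strong_deformation_retract_of T \<longleftrightarrow>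
     S \<subseteq> topspace T \<and>
     (\<exists>h. continuous_map (prod_topology (top_of_set {0..1::real}) T) T h \<and>
          (\<forall>x\<in>topspace T. h (0, x) = x \<and> h (1, x) \<in> S) \<and>
          (\<forall>t\<in>{0..1}. \<forall>s\<in>S. h (t, s) = s))"
  (is "_ \<longleftrightarrow> _ \<and> (\<exists>h. ?H h)")
proof (cases "S \<subseteq> topspace T")
  case True
  have hw: "homotopic_with (\<lambda>h. \<forall>s\<in>S. h s = s) T T id r \<longleftrightarrow>
      (\<exists>h. continuous_map (prod_topology (top_of_set {0..1::real}) T) T h \<and>
           (\<forall>x\<in>topspace T. h (0, x) = id x) \<and> (\<forall>x\<in>topspace T. h (1, x) = r x) \<and>
           (\<forall>t\<in>{0..1}. \<forall>s\<in>S. h (t, s) = s))" for r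
    using True by (subst homotopic_with) (auto simp: subset_iff)
  have "(\<exists>r. retraction_maps T (subtopology T S) r id \<and>
          homotopic_with (\<lambda>h. \<forall>s\<in>S. h s = s) T T id r) \<longleftrightarrow> (\<exists>h. ?H h)"
  proof
    assume "\<exists>r. retraction_maps T (subtopology T S) r id \<and>
          homotopic_with (\<lambda>h. \<forall>s\<in>S. h s = s) T T id r"
    then obtain r h where r: "retraction_maps T (subtopology T S) r id"
      and h: "continuous_map (prod_topology (top_of_set {0..1::real}) T) T h"
        "\<forall>x\<in>topspace T. h (0, x) = id x" "\<forall>x\<in>topspace T. h (1, x) = r x"
        "\<forall>t\<in>{0..1}. \<forall>s\<in>S. h (t, s) = s"
      unfolding hw by blast
    have "r x \<in> S" if "x \<in> topspace T" for x
      using r that by (auto simp: retraction_maps_def continuous_map_in_subtopology)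
    then show "\<exists>h. ?H h"
      using h by (intro exI[of _ h]) simp
  next
    assume "\<exists>h. ?H h"
    then obtain h where h: "?H h" by blast
    let ?r = "h \<circ> Pair 1"
    have "continuous_map T T ?r"
      using h by (intro continuous_map_o_Pair) auto
    then have "retraction_maps T (subtopology T S) ?r id"
      using h True by (auto simp: retraction_maps_def continuous_map_in_subtopology)
    moreover have "homotopic_with (\<lambda>h. \<forall>s\<in>S. h s = s) T T id ?r"
      unfolding hw using h by (intro exI[of _ h]) simp
    ultimately show "\<exists>r. retraction_maps T (subtopology T S) r id \<and>
          homotopic_with (\<lambda>h. \<forall>s\<in>S. h s = s) T T id r"
      by blast
  qed
  with True show ?thesis
    by (simp add: strong_deformation_retract_of_def)
qed (simp add: strong_deformation_retract_of_def)

end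

theory Submission
  imports Defs
begin

text \<open>
  Call a point of the inverse limit a thread: a sequence \<open>C\<close> of non-empty sets
  \<open>C n \<subseteq> A n\<close> of diameter less than \<open>2 * \<epsilon> n\<close> that the bonding maps send to each other.
  Threads are ordered by inclusion in every coordinate, and everything rests on the relation of
  this order to the topology: since the open sets of a finite hyperspace are closed under passing
  to smaller sets, so are the open sets of the limit, and the threads \<open>D\<close> with \<open>D N \<subseteq> C N\<close>, for
  \<open>N = 0, 1, \<dots>\<close>, form a neighbourhood base of \<open>C\<close> (\<open>limit_neighbourhood\<close>).

  The sets \<open>C n\<close> of a thread shrink to a single point of \<open>X\<close>. The distance from a
  point of \<open>X\<close> to \<open>A n\<close> is at most the approximation radius \<open>\<gamma>\<close> of \<open>A n\<close>, and \<open>\<gamma> + 2 * \<epsilon> (Suc n) < \<epsilon> n\<close> by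
  adjustedness; summing this telescoping bound along the thread shows that \<open>C n\<close> lies in the open
  ball of radius \<open>\<epsilon> n\<close> about the limit point \<open>point_of C\<close>, which is the only point with this
  property (\<open>thread_lies_over\<close>, \<open>lies_over_unique\<close>).

  In the other direction, the points of \<open>A m\<close> in the ball of radius \<open>\<epsilon> m\<close> about \<open>x\<close> are mapped
  by the bonding map into the corresponding set one stage lower, so for fixed \<open>n\<close> their images in
  \<open>A n\<close> decrease with \<open>m\<close> and, being finite, become constant. The stable values form a thread
  \<open>core x\<close>, and it is the greatest thread lying over \<open>x\<close> (\<open>core_thread\<close>, \<open>core_greatest\<close>). Both
  \<open>point_of\<close> and \<open>core\<close> are continuous and \<open>point_of (core x) = x\<close>, so \<open>core\<close> embeds \<open>X\<close> onto a
  retract of the limit.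

  Finally \<open>C\<close> is below its retraction \<open>core (point_of C)\<close>. Because open sets are downward closed,
  the homotopy that stands still for \<open>t < 1\<close> and jumps up to the retraction at \<open>t = 1\<close> is
  continuous (\<open>strong_deformation_retract_core\<close>).
\<close>

section \<open>Finite hyperspaces and nearest points\<close>

lemma small_hyperspace_downward_closed:
  assumes "openin (small_hyperspace e B) V" "D \<in> V"
    and "E \<in> topspace (small_hyperspace e B)" "E \<subseteq> D"
  shows "E \<in> V"
proof -
  obtain W where W: "openin (finite_hyperspace B) W"
    and V: "V = W \<inter> {C \<in> nonempty_subsets B. diameter C < 2 * e}"
    using assms(1) unfolding small_hyperspace_def openin_subtopology by blast
  obtain \<U> where "\<U> \<subseteq> {F. \<exists>C. C \<noteq> {} \<and> C \<subseteq> B \<and> F = nonempty_subsets C}" "\<Union>\<U> = W"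
    using W by (auto simp: openin_finite_hyperspace_iff union_of_def)
  moreover have "D \<in> W" "E \<noteq> {}" "E \<subseteq> B" "diameter E < 2 * e"
    using assms V by (auto simp: topspace_small_hyperspace)
  ultimately have "E \<in> W"
    using \<open>E \<subseteq> D\<close> unfolding nonempty_subsets_def by blast
  then show ?thesis
    using V \<open>E \<noteq> {}\<close> \<open>E \<subseteq> B\<close> \<open>diameter E < 2 * e\<close> by (simp add: nonempty_subsets_def)
qed

lemma openin_small_hyperspace_below:
  "openin (small_hyperspace e B) {E \<in> topspace (small_hyperspace e B). E \<subseteq> D}"
proof -
  have "openin (finite_hyperspace B) (nonempty_subsets (D \<inter> B))"
  proof (cases "D \<inter> B = {}")
    case True
    then have "nonempty_subsets (D \<inter> B) = {}" by (auto simp: nonempty_subsets_def)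
    then show ?thesis by simp
  next
    case False
    then show ?thesis
      unfolding finite_hyperspace_def by (blast intro: topology_generated_by_Basis)
  qed
  moreover have "{E \<in> topspace (small_hyperspace e B). E \<subseteq> D}
      = nonempty_subsets (D \<inter> B) \<inter> {C \<in> nonempty_subsets B. diameter C < 2 * e}"
    by (auto simp: topspace_small_hyperspace nonempty_subsets_def)
  ultimately show ?thesis
    unfolding small_hyperspace_def openin_subtopology by blast
qed

lemma nearest_points_nonempty:
  assumes "finite B" "B \<noteq> {}"
  shows "nearest_points B x \<noteq> {}"
proof -
  obtain b where b: "b \<in> B" "setdist {x} B = infdist b {x}"
    using setdist_attains_inf[OF finite_imp_compact[OF assms(1)] assms(2)] .
  then have "infdist x B = dist x b" by (simp add: infdist_eq_setdist[of x B] dist_commute)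
  with b show ?thesis by (auto simp: nearest_points_def)
qed

lemma nearest_map_mono: "C \<subseteq> D \<Longrightarrow> nearest_map B C \<subseteq> nearest_map B D"
  by (auto simp: nearest_map_def)

text \<open>The composite of the bonding maps from stage \<open>n + k\<close> down to stage \<open>n\<close>.\<close>

primrec pull :: "(nat \<Rightarrow> 'a::metric_space set) \<Rightarrow> nat \<Rightarrow> nat \<Rightarrow> 'a set \<Rightarrow> 'a set" where
  "pull A n 0 C = C"
| "pull A n (Suc k) C = pull A n k (nearest_map (A (n + k)) C)"

text \<open>The recursion of \<open>pull\<close> peels off the bonding map at the top stage; the compatibility of
  threads concerns the one at the bottom.\<close>

lemma pull_Suc_left: "pull A n (Suc k) C = nearest_map (A n) (pull A (Suc n) k C)"
  by (induction k arbitrary: C) auto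

lemma pull_mono: "C \<subseteq> D \<Longrightarrow> pull A n k C \<subseteq> pull A n k D"
  by (induction k arbitrary: C D) (auto dest: nearest_map_mono)

text \<open>A member of least cardinality is contained in all the others.\<close>

lemma decseq_finite_sets_stabilise:
  fixes D :: "nat \<Rightarrow> 'a set"
  assumes "finite (D 0)" "\<And>k. D (Suc k) \<subseteq> D k"
  shows "\<exists>K. \<forall>k\<ge>K. D k = (\<Inter>k. D k)"
proof -
  have dec: "decseq D" using assms(2) by (rule decseq_SucI)
  have fin: "finite (D k)" for k
    using assms(1) decseqD[OF dec, of 0 k] finite_subset by blast
  obtain K where K: "\<And>k. card (D K) \<le> card (D k)"
    using ex_has_least_nat[of "\<lambda>_. True" 0 "\<lambda>k. card (D k)"] by blast
  have eq: "D k = D K" if "k \<ge> K" for k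
    using card_seteq[OF fin decseqD[OF dec that] K] .
  have "D K \<subseteq> D k" for k
    using decseqD[OF dec, of k K] eq[of k] by (cases "k \<le> K") auto
  then have "D K = (\<Inter>k. D k)" by blast
  with eq show ?thesis by blast
qed

section \<open>The topology of the inverse limit\<close>

locale fas =
  fixes X :: "'a::metric_space set" and \<epsilon> :: "nat \<Rightarrow> real" and A :: "nat \<Rightarrow> 'a set"
  assumes compact: "compact X"
    and fas: "finite_approximative_sequence X \<epsilon> A"
begin

lemma eps_pos: "0 < \<epsilon> n"
  and eps_tendsto: "\<epsilon> \<longlonglongrightarrow> 0"
  and A_finite: "finite (A n)"
  and A_subset: "A n \<subseteq> X"
  and A_dense: "x \<in> X \<Longrightarrow> \<exists>a\<in>A n. dist x a < \<epsilon> n"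
  and A_adjusted: "adjusted X (\<epsilon> n) (A n) (\<epsilon> (Suc n))"
  using fas by (auto simp: finite_approximative_sequence_def finite_approximation_def)

lemma nearest_points_nonempty_A: "x \<in> X \<Longrightarrow> nearest_points (A n) x \<noteq> {}"
  using nearest_points_nonempty[OF A_finite] A_dense by blast

text \<open>Adjustedness in metric form: the ball of radius \<open>2 * \<epsilon> (Suc n)\<close> about a nearest point of \<open>x\<close>
  stays inside the ball of radius \<open>\<epsilon> n\<close> about \<open>x\<close>.\<close>

lemma dist_nearest_point:
  assumes "x \<in> X" "a \<in> nearest_points (A n) x"
  shows "dist x a + 2 * \<epsilon> (Suc n) < \<epsilon> n"
proof -
  have "infdist y (A n) \<le> \<epsilon> n" if "y \<in> X" for y
    using A_dense[OF that, of n] by (meson infdist_le less_imp_le order_trans)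
  then have "bdd_above ((\<lambda>x. infdist x (A n)) ` X)"
    by (rule bdd_aboveI2)
  then have "infdist x (A n) \<le> approximation_radius X (A n)"
    unfolding approximation_radius_def using assms(1) by (intro cSUP_upper)
  then show ?thesis
    using assms(2) A_adjusted[of n] by (simp add: nearest_points_def adjusted_def)
qed

abbreviation limit where "limit \<equiv> fas_limit \<epsilon> A"

lemma topspace_limit:
  "topspace limit = {C. \<forall>n. C n \<in> topspace (small_hyperspace (\<epsilon> n) (A n)) \<and>
                           nearest_map (A n) (C (Suc n)) = C n}"
  by (auto simp: fas_limit_def inverse_limit_def)

lemma thread_iff:
  "C \<in> topspace limit \<longleftrightarrow> (\<forall>n. C n \<noteq> {} \<and> C n \<subseteq> A n \<and> diameter (C n) < 2 * \<epsilon> n \<and>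
                              nearest_map (A n) (C (Suc n)) = C n)"
  by (auto simp: topspace_limit topspace_small_hyperspace)

lemma thread_subset: "C \<in> topspace limit \<Longrightarrow> C n \<subseteq> X"
  using A_subset[of n] unfolding thread_iff by blast

text \<open>The bonding maps are monotone, so a comparison at one stage passes to all earlier ones.\<close>

lemma thread_le_below:
  assumes "C \<in> topspace limit" "D \<in> topspace limit" "D N \<subseteq> C N" "n \<le> N"
  shows "D n \<subseteq> C n"
  using assms(4,3)
proof (induction rule: inc_induct)
  case (step m)
  then show ?case
    using nearest_map_mono[of "D (Suc m)" "C (Suc m)" "A m"] assms(1,2) by (simp add: thread_iff)
qed

text \<open>A basic open set of the product restricts only finitely many coordinates. By monotonicity of
  the bonding maps the last of these controls the others, and by downward closure it suffices to
  be below \<open>C\<close> there. In particular every open set of the limit is downward closed.\<close>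

lemma limit_neighbourhood:
  assumes "openin limit V" "C \<in> V"
  shows "\<exists>N. \<forall>D\<in>topspace limit. D N \<subseteq> C N \<longrightarrow> D \<in> V"
proof -
  let ?T = "\<lambda>n. small_hyperspace (\<epsilon> n) (A n)"
  have C: "C \<in> topspace limit" using assms openin_subset by blast
  obtain W where W: "openin (product_topology ?T UNIV) W"
    and V: "V = W \<inter> {C. \<forall>n. nearest_map (A n) (C (Suc n)) = C n}"
    using assms(1) unfolding fas_limit_def inverse_limit_def openin_subtopology by blast
  have "C \<in> W" using V assms(2) by blast
  then have "\<exists>U. finite {i \<in> UNIV. U i \<noteq> topspace (?T i)} \<and> (\<forall>i\<in>UNIV. openin (?T i) (U i)) \<and>
      C \<in> Pi\<^sub>E UNIV U \<and> Pi\<^sub>E UNIV U \<subseteq> W"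
    using W unfolding openin_product_topology_alt by blast
  then obtain U where U: "finite {i. U i \<noteq> topspace (?T i)}" "\<And>i. openin (?T i) (U i)"
      "C \<in> Pi\<^sub>E UNIV U" "Pi\<^sub>E UNIV U \<subseteq> W"
    by auto
  obtain N where N: "\<And>i. U i \<noteq> topspace (?T i) \<Longrightarrow> i \<le> N"
    using U(1) by (auto simp: finite_nat_set_iff_bounded_le)
  have "D \<in> V" if D: "D \<in> topspace limit" "D N \<subseteq> C N" for D
  proof -
    have "D i \<in> U i" for i
    proof (cases "U i = topspace (?T i)")
      case True
      then show ?thesis using D(1) by (simp add: topspace_limit)
    next
      case False
      then have "D i \<subseteq> C i" using thread_le_below[OF C D N] by blast
      then show ?thesis
        using small_hyperspace_downward_closed[OF U(2), of "C i"] U(3) D(1)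
        by (auto simp: topspace_limit PiE_iff)
    qed
    then have "D \<in> W" using U(4) by (auto simp: PiE_iff)
    then show ?thesis using D(1) V by (simp add: topspace_limit)
  qed
  then show ?thesis by blast
qed

lemma openin_limit_below: "openin limit {D \<in> topspace limit. D N \<subseteq> B}"
proof -
  have "continuous_map limit (small_hyperspace (\<epsilon> N) (A N)) (\<lambda>D. D N)"
    unfolding fas_limit_def inverse_limit_def
    by (intro continuous_map_from_subtopology continuous_map_product_projection) simp
  from openin_continuous_map_preimage[OF this openin_small_hyperspace_below[of _ _ B]]
  have "openin limit {D \<in> topspace limit. D N \<in> {E \<in> topspace (small_hyperspace (\<epsilon> N) (A N)). E \<subseteq> B}}" .
  moreover have "{D \<in> topspace limit. D N \<in> {E \<in> topspace (small_hyperspace (\<epsilon> N) (A N)). E \<subseteq> B}}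
      = {D \<in> topspace limit. D N \<subseteq> B}"
    by (auto simp: topspace_limit)
  ultimately show ?thesis by simp
qed

section \<open>The point of \<open>X\<close> determined by a thread\<close>

definition lies_over :: "(nat \<Rightarrow> 'a set) \<Rightarrow> 'a \<Rightarrow> bool" where
  "lies_over C x \<longleftrightarrow> x \<in> X \<and> (\<forall>n. C n \<subseteq> ball x (\<epsilon> n))"

lemma dist_in_thread:
  assumes "C \<in> topspace limit" "c \<in> C n" "c' \<in> C n"
  shows "dist c c' < 2 * \<epsilon> n"
proof -
  have "finite (C n)" using assms(1) A_finite[of n] unfolding thread_iff by (blast intro: finite_subset)
  then have "dist c c' \<le> diameter (C n)"
    using assms by (intro diameter_bounded_bound finite_imp_bounded)
  then show ?thesis using assms(1) by (auto simp: thread_iff intro: le_less_trans)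
qed

lemma thread_lift:
  assumes "C \<in> topspace limit" "c \<in> C n"
  shows "\<exists>c'\<in>C (Suc n). dist c c' + 2 * \<epsilon> (Suc n) < \<epsilon> n"
proof -
  have "c \<in> nearest_map (A n) (C (Suc n))" using assms by (simp add: thread_iff)
  then obtain c' where c': "c' \<in> C (Suc n)" "c \<in> nearest_points (A n) c'"
    by (auto simp: nearest_map_def)
  then have "c' \<in> X" using thread_subset[OF assms(1)] by blast
  from dist_nearest_point[OF this c'(2)] c'(1) show ?thesis
    by (auto simp: dist_commute)
qed

text \<open>Lifting a point through the stages, the bounds on the steps telescope.\<close>

lemma thread_lift_far:
  assumes "C \<in> topspace limit" "c \<in> C n" "n \<le> m"
  shows "\<exists>c'\<in>C m. dist c c' \<le> \<epsilon> n - \<epsilon> m"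
  using assms(3)
proof (induction rule: dec_induct)
  case base
  show ?case using assms(2) by auto
next
  case (step m)
  then obtain c' where c': "c' \<in> C m" "dist c c' \<le> \<epsilon> n - \<epsilon> m" by blast
  obtain c'' where c'': "c'' \<in> C (Suc m)" "dist c' c'' + 2 * \<epsilon> (Suc m) < \<epsilon> m"
    using thread_lift[OF assms(1) c'(1)] by blast
  have "dist c c'' \<le> \<epsilon> n - \<epsilon> (Suc m)"
    using c' c'' eps_pos[of "Suc m"] dist_triangle[of c c'' c'] by linarith
  with c'' show ?case by blast
qed

text \<open>Any choice of \<open>c n \<in> C n\<close> has a cluster point by compactness. A point of \<open>C n\<close> is connected
  by a chain of lifts of total length at most \<open>\<epsilon> n - \<epsilon> m\<close> to a point of \<open>C m\<close>, and \<open>C m\<close> has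
  small diameter; hence the cluster point is within \<open>\<epsilon> n\<close> of all of \<open>C n\<close>.\<close>

lemma thread_lies_over:
  assumes C: "C \<in> topspace limit"
  shows "\<exists>x. lies_over C x"
proof -
  have "\<forall>n. \<exists>c. c \<in> C n" using C by (auto simp: thread_iff)
  then obtain c where c: "\<And>n. c n \<in> C n" by metis
  have "c n \<in> X" for n using c thread_subset[OF C] by blast
  then obtain x s where xs: "x \<in> X" "strict_mono s" "(c \<circ> s) \<longlonglongrightarrow> x"
    using compact by (metis compact_imp_seq_compact seq_compactE)
  have le: "dist d x \<le> \<epsilon> n" if d: "d \<in> C n" for d n
  proof (rule LIMSEQ_le)
    show "(\<lambda>k. dist d ((c \<circ> s) k)) \<longlonglongrightarrow> dist d x"
      by (intro tendsto_dist tendsto_const xs)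
    show "(\<lambda>k. \<epsilon> n + (\<epsilon> \<circ> s) k) \<longlonglongrightarrow> \<epsilon> n"
      using tendsto_add[OF tendsto_const LIMSEQ_subseq_LIMSEQ[OF eps_tendsto xs(2)]] by simp
    have "dist d (c (s k)) \<le> \<epsilon> n + \<epsilon> (s k)" if "k \<ge> n" for k
    proof -
      have "n \<le> s k" using that seq_suble[OF xs(2), of k] by linarith
      from thread_lift_far[OF C d this] obtain d' where
        d': "d' \<in> C (s k)" "dist d d' \<le> \<epsilon> n - \<epsilon> (s k)" by blast
      then show ?thesis
        using dist_in_thread[OF C d'(1) c] dist_triangle[of d "c (s k)" d'] by linarith
    qed
    then show "\<exists>K. \<forall>k\<ge>K. dist d ((c \<circ> s) k) \<le> \<epsilon> n + (\<epsilon> \<circ> s) k" by auto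
  qed
  \<comment> \<open>Passing to the limit lost the strict inequality; the slack in a single lift recovers it.\<close>
  have "dist d x < \<epsilon> n" if d: "d \<in> C n" for d n
  proof -
    obtain d' where d': "d' \<in> C (Suc n)" "dist d d' + 2 * \<epsilon> (Suc n) < \<epsilon> n"
      using thread_lift[OF C d] by blast
    then show ?thesis
      using le[OF d'(1)] dist_triangle[of d x d'] eps_pos[of "Suc n"] by linarith
  qed
  then show ?thesis
    using xs(1) by (auto simp: lies_over_def dist_commute)
qed

lemma lies_over_close:
  assumes "lies_over C x" "lies_over D y" "C n \<inter> D n \<noteq> {}"
  shows "dist x y < 2 * \<epsilon> n"
proof -
  obtain c where "c \<in> C n" "c \<in> D n" using assms(3) by blast
  then have "dist x c < \<epsilon> n" "dist y c < \<epsilon> n"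
    using assms(1,2) unfolding lies_over_def by (metis mem_ball subsetD)+
  then show ?thesis using dist_triangle2[of x y c] by linarith
qed

lemma eps_small: "0 < e \<Longrightarrow> \<exists>n. 2 * \<epsilon> n < e"
  using eventually_happens'[OF sequentially_bot order_tendstoD(2)[OF eps_tendsto, of "e / 2"]]
  by (auto simp: field_simps)

lemma lies_over_unique:
  assumes "C \<in> topspace limit" "lies_over C x" "lies_over C y"
  shows "x = y"
proof (rule ccontr)
  assume "x \<noteq> y"
  then obtain n where "2 * \<epsilon> n < dist x y" using eps_small by (metis zero_less_dist_iff)
  moreover have "dist x y < 2 * \<epsilon> n"
    using assms lies_over_close[of C x C y n] by (auto simp: thread_iff)
  ultimately show False by linarith
qed

definition point_of :: "(nat \<Rightarrow> 'a set) \<Rightarrow> 'a" where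
  "point_of C = (THE x. lies_over C x)"

lemma lies_over_point_of:
  assumes "C \<in> topspace limit"
  shows "lies_over C (point_of C)"
proof -
  obtain x where "lies_over C x" using thread_lies_over[OF assms] by blast
  then show ?thesis
    unfolding point_of_def by (rule theI) (rule lies_over_unique[OF assms _ \<open>lies_over C x\<close>])
qed

lemma point_of_eq: "C \<in> topspace limit \<Longrightarrow> lies_over C x \<Longrightarrow> point_of C = x"
  using lies_over_point_of lies_over_unique by blast

text \<open>If \<open>D\<close> is below \<open>C\<close> at stage \<open>n\<close>, the two threads share a point there, so their limit points
  are less than \<open>2 * \<epsilon> n\<close> apart.\<close>

lemma continuous_map_point_of: "continuous_map limit (top_of_set X) point_of"
  unfolding continuous_map_in_subtopology
proof
  show "point_of \<in> topspace limit \<rightarrow> X"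
    using lies_over_point_of by (auto simp: lies_over_def)
  show "continuous_map limit euclidean point_of"
    unfolding continuous_map_def
  proof (intro conjI allI impI)
    fix U :: "'a set" assume "openin euclidean U"
    then have "open U" by simp
    show "openin limit {C \<in> topspace limit. point_of C \<in> U}"
    proof (subst openin_subopen, intro ballI)
      fix C assume "C \<in> {C \<in> topspace limit. point_of C \<in> U}"
      then have C: "C \<in> topspace limit" "point_of C \<in> U" by auto
      obtain e where e: "e > 0" "ball (point_of C) e \<subseteq> U"
        using \<open>open U\<close> C(2) open_contains_ball by blast
      obtain n where n: "2 * \<epsilon> n < e" using eps_small[OF e(1)] by blast
      let ?N = "{D \<in> topspace limit. D n \<subseteq> C n}"
      have "point_of D \<in> U" if "D \<in> ?N" for D
      proof -
        have "D n \<noteq> {}" "D n \<subseteq> C n" using that by (simp_all add: thread_iff)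
        then have "C n \<inter> D n \<noteq> {}" by blast
        then have "dist (point_of C) (point_of D) < 2 * \<epsilon> n"
          using lies_over_close lies_over_point_of C that by blast
        then show ?thesis using e n by auto
      qed
      then show "\<exists>T. openin limit T \<and> C \<in> T \<and> T \<subseteq> {C \<in> topspace limit. point_of C \<in> U}"
        using openin_limit_below[of n "C n"] C(1) by (intro exI[of _ ?N]) auto
    qed
  qed simp
qed

section \<open>The greatest thread over a point\<close>

definition vicinity :: "'a \<Rightarrow> nat \<Rightarrow> 'a set" where
  "vicinity x n = A n \<inter> ball x (\<epsilon> n)"

text \<open>The slack left by adjustedness allows the centre to move as well. The case \<open>x = y\<close> makes the
  images of the vicinities decreasing, the general case gives the continuity of \<open>core\<close>.\<close>

lemma vicinity_step:
  assumes "dist x y \<le> \<epsilon> (Suc n)"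
  shows "nearest_map (A n) (vicinity y (Suc n)) \<subseteq> vicinity x n"
proof
  fix a assume "a \<in> nearest_map (A n) (vicinity y (Suc n))"
  then obtain b where b: "b \<in> A (Suc n)" "dist y b < \<epsilon> (Suc n)" "a \<in> nearest_points (A n) b"
    by (auto simp: nearest_map_def vicinity_def)
  then have "dist b a + 2 * \<epsilon> (Suc n) < \<epsilon> n" using dist_nearest_point A_subset by blast
  then have "dist x a < \<epsilon> n"
    using b(2) assms dist_triangle[of x a b] dist_triangle[of x b y] by linarith
  with b(3) show "a \<in> vicinity x n" by (simp add: vicinity_def nearest_points_def)
qed

text \<open>The vicinities of \<open>x\<close> need not be compatible with the bonding maps; their stable images at
  stage \<open>n\<close> are.\<close>

definition core :: "'a \<Rightarrow> nat \<Rightarrow> 'a set" where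
  "core x n = (\<Inter>k. pull A n k (vicinity x (n + k)))"

lemma pull_vicinity_antimono: "pull A n (Suc k) (vicinity x (n + Suc k)) \<subseteq> pull A n k (vicinity x (n + k))"
  using pull_mono[OF vicinity_step[of x x "n + k"]] eps_pos[of "Suc (n + k)"] by simp

lemma core_stable: "\<exists>K. \<forall>k\<ge>K. pull A n k (vicinity x (n + k)) = core x n"
  unfolding core_def
  by (rule decseq_finite_sets_stabilise[of "\<lambda>k. pull A n k (vicinity x (n + k))"])
     (use pull_vicinity_antimono A_finite in \<open>auto simp: vicinity_def\<close>)

lemma pull_nonempty:
  assumes "C \<noteq> {}" "C \<subseteq> X"
  shows "pull A n k C \<noteq> {}"
  using assms
proof (induction k arbitrary: C)
  case (Suc k)
  have "nearest_map (A (n + k)) C \<noteq> {}"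
    using Suc.prems nearest_points_nonempty_A by (fastforce simp: nearest_map_def)
  moreover have "nearest_map (A (n + k)) C \<subseteq> X"
    using A_subset by (auto simp: nearest_map_def nearest_points_def)
  ultimately show ?case using Suc.IH by simp
qed simp

lemma core_subset: "core x n \<subseteq> vicinity x n"
  unfolding core_def by (rule INF_lower2[of 0]) simp_all

lemma core_nonempty: "x \<in> X \<Longrightarrow> core x n \<noteq> {}"
proof -
  assume "x \<in> X"
  obtain K where "pull A n K (vicinity x (n + K)) = core x n" using core_stable by blast
  moreover have "vicinity x (n + K) \<noteq> {}" using A_dense[OF \<open>x \<in> X\<close>] by (fastforce simp: vicinity_def)
  moreover have "vicinity x (n + K) \<subseteq> X" using A_subset by (auto simp: vicinity_def)
  ultimately show ?thesis using pull_nonempty by metis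
qed

text \<open>Both sides are the image of the vicinity at one sufficiently late stage.\<close>

lemma nearest_map_core: "nearest_map (A n) (core x (Suc n)) = core x n"
proof -
  obtain K L where K: "\<And>k. k \<ge> K \<Longrightarrow> pull A n k (vicinity x (n + k)) = core x n"
    and L: "\<And>k. k \<ge> L \<Longrightarrow> pull A (Suc n) k (vicinity x (Suc n + k)) = core x (Suc n)"
    using core_stable by metis
  let ?k = "max K L"
  have "core x n = pull A n (Suc ?k) (vicinity x (n + Suc ?k))" using K[of "Suc ?k"] by simp
  also have "\<dots> = nearest_map (A n) (pull A (Suc n) ?k (vicinity x (Suc n + ?k)))"
    unfolding pull_Suc_left by simp
  also have "\<dots> = nearest_map (A n) (core x (Suc n))" using L[of ?k] by simp
  finally show ?thesis by simp
qed

lemma core_thread: assumes "x \<in> X" shows "core x \<in> topspace limit"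
proof -
  have "diameter (core x n) < 2 * \<epsilon> n" for n
  proof -
    have "finite (core x n)" using core_subset A_finite finite_subset by (fastforce simp: vicinity_def)
    then obtain a b where "a \<in> core x n" "b \<in> core x n" "dist a b = diameter (core x n)"
      using diameter_compact_attained[OF finite_imp_compact core_nonempty[OF assms]] by blast
    moreover then have "dist x a < \<epsilon> n" "dist x b < \<epsilon> n"
      using core_subset by (auto simp: vicinity_def subset_iff)
    ultimately show ?thesis using dist_triangle3[of a b x] by linarith
  qed
  then show ?thesis
    using core_nonempty[OF assms] core_subset nearest_map_core
    by (auto simp: thread_iff vicinity_def subset_iff)
qed

lemma lies_over_core: "x \<in> X \<Longrightarrow> lies_over (core x) x"
  using core_subset by (auto simp: lies_over_def vicinity_def subset_iff)

text \<open>A thread over \<open>x\<close> consists of subsets of the vicinities of \<open>x\<close> and is reproduced by pulling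
  it back.\<close>

lemma core_greatest:
  assumes "C \<in> topspace limit" "lies_over C x"
  shows "C n \<subseteq> core x n"
proof -
  have "pull A n k (C (n + k)) = C n" for k
    using assms(1) by (induction k) (auto simp: thread_iff)
  moreover have "C (n + k) \<subseteq> vicinity x (n + k)" for k
    using assms by (auto simp: thread_iff lies_over_def vicinity_def)
  ultimately show ?thesis
    unfolding core_def using pull_mono[of "C (n + _)"] by (intro INF_greatest) metis
qed

lemma point_of_core: "x \<in> X \<Longrightarrow> point_of (core x) = x"
  by (rule point_of_eq[OF core_thread lies_over_core])

text \<open>If \<open>core x n\<close> is the image of the vicinity of \<open>x\<close> at stage \<open>n + K\<close>, then for \<open>y\<close> near \<open>x\<close> the
  vicinity of \<open>y\<close> one stage later is mapped into that vicinity of \<open>x\<close>.\<close>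

lemma core_locally_below:
  "\<exists>d>0. \<forall>y. dist x y < d \<longrightarrow> core y n \<subseteq> core x n"
proof -
  obtain K where K: "pull A n K (vicinity x (n + K)) = core x n" using core_stable by blast
  have "core y n \<subseteq> core x n" if "dist x y < \<epsilon> (Suc (n + K))" for y
  proof -
    have "core y n \<subseteq> pull A n (Suc K) (vicinity y (n + Suc K))" unfolding core_def by blast
    also have "\<dots> \<subseteq> pull A n K (vicinity x (n + K))"
      using pull_mono[OF vicinity_step] that by simp
    finally show ?thesis using K by simp
  qed
  then show ?thesis using eps_pos by blast
qed

lemma continuous_map_core: "continuous_map (top_of_set X) limit core"
  unfolding continuous_map_def
proof (intro conjI allI impI)
  show "core \<in> topspace (top_of_set X) \<rightarrow> topspace limit" using core_thread by auto
  fix V assume V: "openin limit V"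
  show "openin (top_of_set X) {x \<in> topspace (top_of_set X). core x \<in> V}"
  proof (subst openin_subopen, intro ballI)
    fix x assume "x \<in> {x \<in> topspace (top_of_set X). core x \<in> V}"
    then have x: "x \<in> X" "core x \<in> V" by auto
    obtain N where N: "\<And>D. D \<in> topspace limit \<Longrightarrow> D N \<subseteq> core x N \<Longrightarrow> D \<in> V"
      using limit_neighbourhood[OF V x(2)] by blast
    obtain d where d: "d > 0" "\<And>y. dist x y < d \<Longrightarrow> core y N \<subseteq> core x N"
      using core_locally_below by blast
    have "openin (top_of_set X) (X \<inter> ball x d)" by (simp add: openin_open_Int)
    moreover have "X \<inter> ball x d \<subseteq> {x \<in> topspace (top_of_set X). core x \<in> V}"
      using N d core_thread by auto
    ultimately show "\<exists>T. openin (top_of_set X) T \<and> x \<in> T \<and>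
        T \<subseteq> {x \<in> topspace (top_of_set X). core x \<in> V}"
      using x d(1) by (intro exI[of _ "X \<inter> ball x d"]) auto
  qed
qed

section \<open>The embedded copy of \<open>X\<close> is a strong deformation retract\<close>

lemma homeomorphic_core: "subtopology limit (core ` X) homeomorphic_space top_of_set X"
  unfolding homeomorphic_space_def homeomorphic_maps_def
proof (intro exI conjI)
  show "continuous_map (subtopology limit (core ` X)) (top_of_set X) point_of"
    by (rule continuous_map_from_subtopology[OF continuous_map_point_of])
  show "continuous_map (top_of_set X) (subtopology limit (core ` X)) core"
    using continuous_map_core by (simp add: continuous_map_in_subtopology image_subset_iff_funcset[symmetric])
qed (auto simp: point_of_core)

text \<open>The homotopy is constant for \<open>t < 1\<close> and jumps to the retraction at \<open>t = 1\<close>. The preimage of an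
  open \<open>V\<close> is \<open>{0..<1} \<times> V\<close> together with \<open>{1} \<times> W\<close>, where \<open>W\<close> is the preimage of \<open>V\<close> under the
  retraction. As every thread is below its retraction and \<open>V\<close> is downward closed, \<open>W \<subseteq> V\<close>; so the
  second part may be enlarged to the open set \<open>{0..1} \<times> W\<close>.\<close>

lemma strong_deformation_retract_core: "(core ` X) strong_deformation_retract_of limit"
proof -
  let ?r = "core \<circ> point_of"
  let ?h = "\<lambda>(t::real, C). if t < 1 then C else ?r C"
  let ?I = "top_of_set {0..1::real}"
  have r: "continuous_map limit limit ?r"
    by (rule continuous_map_compose[OF continuous_map_point_of continuous_map_core])
  have "continuous_map (prod_topology ?I limit) limit ?h"
    unfolding continuous_map_def
  proof (intro conjI allI impI)
    show "?h \<in> topspace (prod_topology ?I limit) \<rightarrow> topspace limit"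
      using continuous_map_image_subset_topspace[OF r] by auto
    fix V assume V: "openin limit V"
    let ?W = "{C \<in> topspace limit. ?r C \<in> V}"
    have VT: "V \<subseteq> topspace limit" using V openin_subset by blast
    have WV: "?W \<subseteq> V"
    proof
      fix C assume C: "C \<in> ?W"
      then obtain N where "\<And>D. D \<in> topspace limit \<Longrightarrow> D N \<subseteq> ?r C N \<Longrightarrow> D \<in> V"
        using limit_neighbourhood[OF V] by blast
      then show "C \<in> V" using C core_greatest lies_over_point_of by auto
    qed
    have "{z \<in> topspace (prod_topology ?I limit). ?h z \<in> V}
        = {0..<1} \<times> V \<union> {0..1} \<times> ?W"
      using VT WV by (auto split: if_splits)
    moreover have "openin ?I {0..<1}"
      unfolding openin_open by (intro exI[of _ "{..<1}"]) auto
    then have "openin (prod_topology ?I limit) ({0..<1} \<times> V)"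
      using V by (simp add: openin_prod_Times_iff)
    moreover have "openin ?I {0..1}" by simp
    then have "openin (prod_topology ?I limit) ({0..1} \<times> ?W)"
      using openin_continuous_map_preimage[OF r V] by (simp add: openin_prod_Times_iff)
    ultimately show "openin (prod_topology ?I limit) {z \<in> topspace (prod_topology ?I limit). ?h z \<in> V}"
      by (simp only: openin_Un)
  qed
  moreover have "?r C \<in> core ` X" if "C \<in> topspace limit" for C
    using lies_over_point_of[OF that] by (auto simp: lies_over_def)
  moreover have "core ` X \<subseteq> topspace limit" using core_thread by blast
  ultimately show ?thesis
    unfolding strong_deformation_retract_of_iff
    by (intro conjI exI[of _ ?h]) (auto simp: point_of_core)
qed

end

theorem theorem6:
  fixes X :: "'a::metric_space set"
    and \<epsilon> :: "nat \<Rightarrow> real"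
    and A :: "nat \<Rightarrow> 'a set"
  assumes "compact X"
    and "finite_approximative_sequence X \<epsilon> A"
  shows "\<exists>S. S \<subseteq> topspace (fas_limit \<epsilon> A) \<and>
             subtopology (fas_limit \<epsilon> A) S homeomorphic_space top_of_set X \<and>
             S strong_deformation_retract_of fas_limit \<epsilon> A"
proof -
  interpret fas X \<epsilon> A using assms by unfold_locales
  show ?thesis
    using core_thread homeomorphic_core strong_deformation_retract_core
    by (intro exI[of _ "core ` X"]) auto
qed

end
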